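(* Let $\mathcal{G}$ be a groupoid, suppose that $\mathcal{B}$ is a $\mathcal{G}$-graded $R$-category and that $\mathcal{G}_0$ is finite. Then the $R$-semicategories $\mathcal{B}\otimes\mathcal{G}$ and $\mathcal{B}\#\mathcal{G}$ are $R$-categories.
   Context: $R$ is a commutative ring with identity. An $R$-semicategory $\mathcal{C}$ is a semicategory (like a category, but identity morphisms are not required) whose set of morphisms ${}_y\mathcal{C}_x$ from $x$ to $y$ is an $R$-module and whose composition ${}_z\mathcal{C}_y\times{}_y\mathcal{C}_x\to{}_z\mathcal{C}_x$, $(f,g)\mapsto fg$, is $R$-bilinear; all $R$-semicategories are small, with object set $\mathcal{C}_0$. An $R$-category is an $R$-semicategory with identity morphisms. Groupoids: $\mathcal{G}$ is a small category with all morphisms invertible, $\mathrm{mor}(\mathcal{G})$ its set of morphisms, $d(g)=g^{-1}g$, $r(g)=gg^{-1}$, $\mathcal{G}_0$ the set of identities; $gh$ exists iff $d(g)=r(h)$. ${}_f\mathcal{G}_e$ is the set of $g\in\mathrm{mor}(\mathcal{G})$ with $d(g)=e$, $r(g)=f$. A $\mathcal{G}$-graded $R$-(semi)category is an $R$-(semi)category $\mathcal{B}$ with decompositions ${}_y\mathcal{B}_x=\bigoplus_{g\in\mathrm{mor}(\mathcal{G})}{}_y\mathcal{B}_x^g$ into $R$-submodules such that, for all objects $x,y,z$, ${}_z\mathcal{B}_y^t\,{}_y\mathcal{B}_x^s\subseteq{}_z\mathcal{B}_x^{ts}$ if $d(t)=r(s)$ and ${}_z\mathcal{B}_y^t\,{}_y\mathcal{B}_x^s=\{0\}$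 otherwise. $\mathcal{B}\otimes\mathcal{G}$ is the semicategory with objects $\mathcal{B}_0\times\mathcal{G}_0$ and morphisms ${}_{(y,f)}(\mathcal{B}\otimes\mathcal{G})_{(x,e)}=\bigoplus_{g\in{}_f\mathcal{G}_e}{}_y\mathcal{B}_x^g$, with composition from $\mathcal{B}$. The smash product $\mathcal{B}\#\mathcal{G}$ is the semicategory with objects $\mathcal{B}_0\times\mathrm{mor}(\mathcal{G})$ and morphisms ${}_{(y,t)}(\mathcal{B}\#\mathcal{G})_{(x,s)}={}_y\mathcal{B}_x^{t^{-1}s}$ if $r(t)=r(s)$ and $0$ otherwise, with composition ${}_z\mathcal{B}_y^{u^{-1}t}\otimes{}_y\mathcal{B}_x^{t^{-1}s}\to{}_z\mathcal{B}_x^{u^{-1}s}$ given by the graded composition of $\mathcal{B}$. *)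

theory Defs
  imports "HOL-Algebra.Module"
begin

section \<open>Groupoids\<close>

record ('a, 'g) small_cat =
  Objs :: "'a set"
  Mor :: "'g set"
  Src :: "'g \<Rightarrow> 'a"
  Tgt :: "'g \<Rightarrow> 'a"
  Ident :: "'a \<Rightarrow> 'g"
  Cmp :: "'g \<Rightarrow> 'g \<Rightarrow> 'g"  (infixl \<open>\<star>\<index>\<close> 70)

text \<open>Composition is written as in \<open>g h\<close> with \<open>h\<close> applied first.\<close>

locale small_category =
  fixes G :: "('a, 'g, 'u) small_cat_scheme" (structure)
  assumes Src_closed: "g \<in> Mor G \<Longrightarrow> Src G g \<in> Objs G"
    and Tgt_closed: "g \<in> Mor G \<Longrightarrow> Tgt G g \<in> Objs G"
    and Ident_closed: "a \<in> Objs G \<Longrightarrow> Ident G a \<in> Mor G"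
    and Src_Ident: "a \<in> Objs G \<Longrightarrow> Src G (Ident G a) = a"
    and Tgt_Ident: "a \<in> Objs G \<Longrightarrow> Tgt G (Ident G a) = a"
    and Cmp_closed: "\<lbrakk>g \<in> Mor G; h \<in> Mor G; Src G g = Tgt G h\<rbrakk> \<Longrightarrow> g \<star> h \<in> Mor G"
    and Src_Cmp: "\<lbrakk>g \<in> Mor G; h \<in> Mor G; Src G g = Tgt G h\<rbrakk> \<Longrightarrow> Src G (g \<star> h) = Src G h"
    and Tgt_Cmp: "\<lbrakk>g \<in> Mor G; h \<in> Mor G; Src G g = Tgt G h\<rbrakk> \<Longrightarrow> Tgt G (g \<star> h) = Tgt G g"
    and Cmp_assoc: "\<lbrakk>g \<in> Mor G; h \<in> Mor G; k \<in> Mor G; Src G g = Tgt G h; Src G h = Tgt G k\<rbrakk>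
                      \<Longrightarrow> (g \<star> h) \<star> k = g \<star> (h \<star> k)"
    and Ident_left: "g \<in> Mor G \<Longrightarrow> Ident G (Tgt G g) \<star> g = g"
    and Ident_right: "g \<in> Mor G \<Longrightarrow> g \<star> Ident G (Src G g) = g"

definition is_inverse :: "('a, 'g, 'u) small_cat_scheme \<Rightarrow> 'g \<Rightarrow> 'g \<Rightarrow> bool" where
  "is_inverse G g h \<longleftrightarrow> h \<in> Mor G \<and> Src G h = Tgt G g \<and> Tgt G h = Src G g
     \<and> h \<star>\<^bsub>G\<^esub> g = Ident G (Src G g) \<and> g \<star>\<^bsub>G\<^esub> h = Ident G (Tgt G g)"

locale groupoid = small_category +
  assumes invertible: "g \<in> Mor G \<Longrightarrow> \<exists>h. is_inverse G g h"

definition ginv :: "('a, 'g, 'u) small_cat_scheme \<Rightarrow> 'g \<Rightarrow> 'g" where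
  "ginv G g = (THE h. is_inverse G g h)"

text \<open>The source and target of a morphism, regarded as identity morphisms.\<close>

definition gd :: "('a, 'g, 'u) small_cat_scheme \<Rightarrow> 'g \<Rightarrow> 'g" where
  "gd G g = ginv G g \<star>\<^bsub>G\<^esub> g"

definition gr :: "('a, 'g, 'u) small_cat_scheme \<Rightarrow> 'g \<Rightarrow> 'g" where
  "gr G g = g \<star>\<^bsub>G\<^esub> ginv G g"

definition identities :: "('a, 'g, 'u) small_cat_scheme \<Rightarrow> 'g set" where
  "identities G = Ident G ` Objs G"

definition gpd_hom :: "('a, 'g, 'u) small_cat_scheme \<Rightarrow> 'g \<Rightarrow> 'g \<Rightarrow> 'g set" where
  "gpd_hom G f e = {g \<in> Mor G. gd G g = e \<and> gr G g = f}"


section \<open>Categories enriched in modules\<close>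

text \<open>
  \<open>SHom C y x\<close> is the module of morphisms from \<open>x\<close> to \<open>y\<close>, and \<open>SComp C z y x f g\<close> is the
  composite \<open>f g\<close> of \<open>g\<close> from \<open>x\<close> to \<open>y\<close> and \<open>f\<close> from \<open>y\<close> to \<open>z\<close>.  The morphism modules
  need not be disjoint as sets, since every operation is indexed by the objects.  The ring
  fields \<open>mult\<close> and \<open>one\<close> of the module records play no role.
\<close>

record ('o, 'r, 'm) semicat =
  SObj :: "'o set"
  SHom :: "'o \<Rightarrow> 'o \<Rightarrow> ('r, 'm) module"
  SComp :: "'o \<Rightarrow> 'o \<Rightarrow> 'o \<Rightarrow> 'm \<Rightarrow> 'm \<Rightarrow> 'm"

locale R_semicategory = cring R
  for R :: "('r, 'u) ring_scheme" (structure) +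
  fixes C :: "('o, 'r, 'm, 'v) semicat_scheme"
  assumes SHom_module: "\<lbrakk>x \<in> SObj C; y \<in> SObj C\<rbrakk> \<Longrightarrow> module R (SHom C y x)"
    and SComp_closed:
      "\<lbrakk>x \<in> SObj C; y \<in> SObj C; z \<in> SObj C;
        f \<in> carrier (SHom C z y); g \<in> carrier (SHom C y x)\<rbrakk>
       \<Longrightarrow> SComp C z y x f g \<in> carrier (SHom C z x)"
    and SComp_assoc:
      "\<lbrakk>w \<in> SObj C; x \<in> SObj C; y \<in> SObj C; z \<in> SObj C;
        f \<in> carrier (SHom C z y); g \<in> carrier (SHom C y x); h \<in> carrier (SHom C x w)\<rbrakk>
       \<Longrightarrow> SComp C z x w (SComp C z y x f g) h = SComp C z y w f (SComp C y x w g h)"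
    and SComp_add_left:
      "\<lbrakk>x \<in> SObj C; y \<in> SObj C; z \<in> SObj C; f \<in> carrier (SHom C z y);
        f' \<in> carrier (SHom C z y); g \<in> carrier (SHom C y x)\<rbrakk>
       \<Longrightarrow> SComp C z y x (f \<oplus>\<^bsub>SHom C z y\<^esub> f') g
           = SComp C z y x f g \<oplus>\<^bsub>SHom C z x\<^esub> SComp C z y x f' g"
    and SComp_add_right:
      "\<lbrakk>x \<in> SObj C; y \<in> SObj C; z \<in> SObj C; f \<in> carrier (SHom C z y);
        g \<in> carrier (SHom C y x); g' \<in> carrier (SHom C y x)\<rbrakk>
       \<Longrightarrow> SComp C z y x f (g \<oplus>\<^bsub>SHom C y x\<^esub> g')
           = SComp C z y x f g \<oplus>\<^bsub>SHom C z x\<^esub> SComp C z y x f g'"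
    and SComp_smult_left:
      "\<lbrakk>x \<in> SObj C; y \<in> SObj C; z \<in> SObj C; a \<in> carrier R;
        f \<in> carrier (SHom C z y); g \<in> carrier (SHom C y x)\<rbrakk>
       \<Longrightarrow> SComp C z y x (a \<odot>\<^bsub>SHom C z y\<^esub> f) g = a \<odot>\<^bsub>SHom C z x\<^esub> SComp C z y x f g"
    and SComp_smult_right:
      "\<lbrakk>x \<in> SObj C; y \<in> SObj C; z \<in> SObj C; a \<in> carrier R;
        f \<in> carrier (SHom C z y); g \<in> carrier (SHom C y x)\<rbrakk>
       \<Longrightarrow> SComp C z y x f (a \<odot>\<^bsub>SHom C y x\<^esub> g) = a \<odot>\<^bsub>SHom C z x\<^esub> SComp C z y x f g"

locale R_category = R_semicategory +
  assumes identity_exists: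
    "x \<in> SObj C \<Longrightarrow> \<exists>i \<in> carrier (SHom C x x). \<forall>y \<in> SObj C.
       (\<forall>f \<in> carrier (SHom C y x). SComp C y x x f i = f) \<and>
       (\<forall>f \<in> carrier (SHom C x y). SComp C x x y i f = f)"


section \<open>Direct sums of submodules\<close>

text \<open>
  Families are extended by zero outside the index set, so that a family indexed by \<open>I\<close> is
  determined as a function.
\<close>

definition fin_families :: "('r, 'm, 'v) module_scheme \<Rightarrow> 'i set \<Rightarrow> ('i \<Rightarrow> 'm set) \<Rightarrow> ('i \<Rightarrow> 'm) set"
  where "fin_families M I N =
    {n. (\<forall>i \<in> I. n i \<in> N i) \<and> (\<forall>i. i \<notin> I \<longrightarrow> n i = \<zero>\<^bsub>M\<^esub>) \<and> finite {i \<in> I. n i \<noteq> \<zero>\<^bsub>M\<^esub>}}"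

definition family_sum :: "('r, 'm, 'v) module_scheme \<Rightarrow> 'i set \<Rightarrow> ('i \<Rightarrow> 'm) \<Rightarrow> 'm" where
  "family_sum M I n = finsum M n {i \<in> I. n i \<noteq> \<zero>\<^bsub>M\<^esub>}"

definition sum_of_submodules ::
    "('r, 'm, 'v) module_scheme \<Rightarrow> 'i set \<Rightarrow> ('i \<Rightarrow> 'm set) \<Rightarrow> 'm set" where
  "sum_of_submodules M I N = family_sum M I ` fin_families M I N"

definition is_direct_sum ::
    "('r, 'u) ring_scheme \<Rightarrow> ('r, 'm, 'v) module_scheme \<Rightarrow> 'i set \<Rightarrow> ('i \<Rightarrow> 'm set) \<Rightarrow> bool" where
  "is_direct_sum R M I N \<longleftrightarrow> (\<forall>i \<in> I. submodule (N i) R M) \<and>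
     (\<forall>m \<in> carrier M. \<exists>!n. n \<in> fin_families M I N \<and> m = family_sum M I n)"


section \<open>Graded categories, the tensor product and the smash product\<close>

text \<open>\<open>Deg B y x g\<close> is the component of degree \<open>g\<close> of the module of morphisms from \<open>x\<close> to \<open>y\<close>.\<close>

record ('o, 'r, 'm, 'g) graded_semicat = "('o, 'r, 'm) semicat" +
  Deg :: "'o \<Rightarrow> 'o \<Rightarrow> 'g \<Rightarrow> 'm set"

locale graded_R_semicategory = R_semicategory R B + groupoid G
  for R :: "('r, 'u) ring_scheme" (structure)
    and G :: "('a, 'g, 'w) small_cat_scheme"
    and B :: "('o, 'r, 'm, 'g, 'v) graded_semicat_scheme" +
  assumes Deg_direct_sum:
      "\<lbrakk>x \<in> SObj B; y \<in> SObj B\<rbrakk> \<Longrightarrow> is_direct_sum R (SHom B y x) (Mor G) (Deg B y x)"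
    and Deg_comp:
      "\<lbrakk>x \<in> SObj B; y \<in> SObj B; z \<in> SObj B; t \<in> Mor G; s \<in> Mor G; gd G t = gr G s;
        f \<in> Deg B z y t; g \<in> Deg B y x s\<rbrakk>
       \<Longrightarrow> SComp B z y x f g \<in> Deg B z x (t \<star>\<^bsub>G\<^esub> s)"
    and Deg_comp_zero:
      "\<lbrakk>x \<in> SObj B; y \<in> SObj B; z \<in> SObj B; t \<in> Mor G; s \<in> Mor G; gd G t \<noteq> gr G s;
        f \<in> Deg B z y t; g \<in> Deg B y x s\<rbrakk>
       \<Longrightarrow> SComp B z y x f g = \<zero>\<^bsub>SHom B z x\<^esub>"

locale graded_R_category = graded_R_semicategory R G B + R_category R B
  for R :: "('r, 'u) ring_scheme" (structure)
    and G :: "('a, 'g, 'w) small_cat_scheme"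
    and B :: "('o, 'r, 'm, 'g, 'v) graded_semicat_scheme"

text \<open>
  Since the components of \<open>SHom B y x\<close> form a direct sum, so do those of degree in a subset of
  the morphisms of \<open>G\<close>; their direct sum is taken inside \<open>SHom B y x\<close>.
\<close>

definition tensor_gpd ::
    "('o, 'r, 'm, 'g, 'v) graded_semicat_scheme \<Rightarrow> ('a, 'g, 'w) small_cat_scheme
      \<Rightarrow> ('o \<times> 'g, 'r, 'm) semicat" where
  "tensor_gpd B G =
    \<lparr> SObj = SObj B \<times> identities G,
      SHom = (\<lambda>(y, f) (x, e).
        (SHom B y x)\<lparr>carrier := sum_of_submodules (SHom B y x) (gpd_hom G f e) (Deg B y x)\<rparr>),
      SComp = (\<lambda>(z, _) (y, _) (x, _). SComp B z y x) \<rparr>"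

definition smash_gpd ::
    "('o, 'r, 'm, 'g, 'v) graded_semicat_scheme \<Rightarrow> ('a, 'g, 'w) small_cat_scheme
      \<Rightarrow> ('o \<times> 'g, 'r, 'm) semicat" where
  "smash_gpd B G =
    \<lparr> SObj = SObj B \<times> Mor G,
      SHom = (\<lambda>(y, t) (x, s).
        (SHom B y x)\<lparr>carrier :=
          (if gr G t = gr G s then Deg B y x (ginv G t \<star>\<^bsub>G\<^esub> s) else {\<zero>\<^bsub>SHom B y x\<^esub>})\<rparr>),
      SComp = (\<lambda>(z, _) (y, _) (x, _). SComp B z y x) \<rparr>"

end

theory Submission
  imports Defs
begin

text \<open>
  The identity morphism of an object \<open>x\<close> of \<open>B\<close> need not be homogeneous, but it has a component
  of degree \<open>e\<close> for every identity \<open>e\<close> of the groupoid, and this component acts as an identity on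
  the homogeneous morphisms whose degree starts or ends at \<open>e\<close>.  Indeed, decompose the identity of
  \<open>x\<close> as \<open>\<Sum>h. n\<^sub>h\<close>.  If \<open>f\<close> is homogeneous of degree \<open>g\<close>, then \<open>f = \<Sum>h. f n\<^sub>h\<close>, where \<open>f n\<^sub>h\<close> is
  zero or of degree \<open>g h\<close>.  Since \<open>g h = g\<close> only for \<open>h = d(g)\<close>, uniqueness of the decomposition
  forces \<open>f = f n\<^sub>e\<close> with \<open>e = d(g)\<close>, and symmetrically on the other side.  This is
  \<open>homogeneous_local_identity\<close>; the uniqueness argument is \<open>direct_sum_compare_component\<close>.

  In the tensor product, the morphisms starting at \<open>(x, e)\<close> are sums of homogeneous ones whose
  degree starts at \<open>e\<close>, so \<open>n\<^sub>e\<close> is the identity of \<open>(x, e)\<close>.  In the smash product, those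
  starting at \<open>(x, s)\<close> are homogeneous of a degree \<open>t\<^sup>-\<^sup>1 s\<close>, which starts at \<open>d(s)\<close>, so the
  component of degree \<open>d(s) = s\<^sup>-\<^sup>1 s\<close> is the identity of \<open>(x, s)\<close>.  Morphisms ending at these
  objects behave in the same way.

  The semicategory axioms pass from \<open>B\<close> to both constructions because their morphism modules are
  submodules of those of \<open>B\<close> that are closed under the composition of \<open>B\<close>
  (\<open>pullback_R_category\<close>).
\<close>

section \<open>Sums of submodules\<close>

context module
begin

lemma submodule_zero: "submodule H R M \<Longrightarrow> \<zero>\<^bsub>M\<^esub> \<in> H"
  using subgroup.one_closed[OF submodule.axioms(1)] by force

lemma submodule_sum_closed:
  assumes "submodule H R M" "\<And>i. i \<in> A \<Longrightarrow> c i \<in> H"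
  shows "finsum M c A \<in> H"
  using assms(2)
proof (induction A rule: infinite_finite_induct)
  case (insert i A)
  have "c ` insert i A \<subseteq> carrier M"
    using insert.prems submoduleE(1)[OF assms(1)] by blast
  then have "finsum M c (insert i A) = c i \<oplus>\<^bsub>M\<^esub> finsum M c A"
    using insert.hyps by (intro M.finsum_insert) auto
  then show ?case
    using insert submoduleE(5)[OF assms(1)] by simp
qed (simp_all add: submodule_zero[OF assms(1)])

lemma zero_submodule: "submodule {\<zero>\<^bsub>M\<^esub>} R M"
  by (rule submoduleI) auto

lemma family_sum_superset:
  assumes "finite A" "{i \<in> I. n i \<noteq> \<zero>\<^bsub>M\<^esub>} \<subseteq> A"
    and "\<And>i. i \<in> A \<Longrightarrow> n i \<in> carrier M" "\<And>i. i \<notin> I \<Longrightarrow> n i = \<zero>\<^bsub>M\<^esub>"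
  shows "family_sum M I n = finsum M n A"
  unfolding family_sum_def
  by (rule M.add.finprod_mono_neutral_cong_left) (use assms in auto)

lemma fin_families_zero:
  assumes "\<And>i. i \<in> I \<Longrightarrow> submodule (N i) R M"
  shows "(\<lambda>i. \<zero>\<^bsub>M\<^esub>) \<in> fin_families M I N"
  using submodule_zero[OF assms] by (simp add: fin_families_def)

lemma sum_of_submodules_submodule:
  assumes N: "\<And>i. i \<in> I \<Longrightarrow> submodule (N i) R M"
  shows "submodule (sum_of_submodules M I N) R M"
proof (rule submoduleI)
  have in_carrier: "n i \<in> carrier M" if "n \<in> fin_families M I N" for n i
    using that submoduleE(1)[OF N] by (cases "i \<in> I") (auto simp: fin_families_def)
  have support: "finite {i \<in> I. n i \<noteq> \<zero>\<^bsub>M\<^esub>}" "\<And>i. i \<notin> I \<Longrightarrow> n i = \<zero>\<^bsub>M\<^esub>"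
    if "n \<in> fin_families M I N" for n
    using that by (auto simp: fin_families_def)
  show "sum_of_submodules M I N \<subseteq> carrier M"
    using in_carrier by (auto simp: sum_of_submodules_def family_sum_def intro!: M.finsum_closed)
  show "\<zero>\<^bsub>M\<^esub> \<in> sum_of_submodules M I N"
    unfolding sum_of_submodules_def
    by (rule image_eqI[OF _ fin_families_zero[OF N]]) (auto simp: family_sum_def)
  show add: "a \<oplus>\<^bsub>M\<^esub> b \<in> sum_of_submodules M I N"
    if a: "a \<in> sum_of_submodules M I N" and b: "b \<in> sum_of_submodules M I N" for a b
  proof -
    obtain n where n: "n \<in> fin_families M I N" "a = family_sum M I n"
      using a by (auto simp: sum_of_submodules_def)
    obtain k where k: "k \<in> fin_families M I N" "b = family_sum M I k"
      using b by (auto simp: sum_of_submodules_def)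
    let ?A = "{i \<in> I. n i \<noteq> \<zero>\<^bsub>M\<^esub>} \<union> {i \<in> I. k i \<noteq> \<zero>\<^bsub>M\<^esub>}"
    let ?s = "\<lambda>i. n i \<oplus>\<^bsub>M\<^esub> k i"
    have fin: "finite ?A"
      using support(1)[OF n(1)] support(1)[OF k(1)] by simp
    have sub: "{i \<in> I. ?s i \<noteq> \<zero>\<^bsub>M\<^esub>} \<subseteq> ?A"
      by auto
    have s: "?s \<in> fin_families M I N"
      using n(1) k(1) submoduleE(5)[OF N] finite_subset[OF sub fin]
      by (auto simp: fin_families_def)
    have "a \<oplus>\<^bsub>M\<^esub> b = finsum M n ?A \<oplus>\<^bsub>M\<^esub> finsum M k ?A"
      unfolding n(2) k(2)
      using family_sum_superset[of ?A I n] family_sum_superset[of ?A I k] fin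
        in_carrier[OF n(1)] in_carrier[OF k(1)] support(2)[OF n(1)] support(2)[OF k(1)]
      by auto
    also have "\<dots> = finsum M ?s ?A"
      using in_carrier[OF n(1)] in_carrier[OF k(1)] by (simp add: M.finsum_addf Pi_iff)
    also have "\<dots> = family_sum M I ?s"
      by (rule family_sum_superset[symmetric])
        (use fin sub in_carrier[OF s] support(2)[OF s] in auto)
    finally show ?thesis
      using s by (auto simp: sum_of_submodules_def)
  qed
  show smult: "r \<odot>\<^bsub>M\<^esub> a \<in> sum_of_submodules M I N"
    if r: "r \<in> carrier R" and a: "a \<in> sum_of_submodules M I N" for r a
  proof -
    obtain n where n: "n \<in> fin_families M I N" "a = family_sum M I n"
      using a by (auto simp: sum_of_submodules_def)
    let ?A = "{i \<in> I. n i \<noteq> \<zero>\<^bsub>M\<^esub>}"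
    let ?s = "\<lambda>i. r \<odot>\<^bsub>M\<^esub> n i"
    have sub: "{i \<in> I. ?s i \<noteq> \<zero>\<^bsub>M\<^esub>} \<subseteq> ?A"
      using r by auto
    have s: "?s \<in> fin_families M I N"
      using n(1) r submoduleE(4)[OF N] finite_subset[OF sub support(1)[OF n(1)]]
      by (auto simp: fin_families_def)
    have "r \<odot>\<^bsub>M\<^esub> a = finsum M ?s ?A"
      unfolding n(2) family_sum_def
      using finsum_smult_ldistr[OF support(1)[OF n(1)] r] in_carrier[OF n(1)] by blast
    also have "\<dots> = family_sum M I ?s"
      by (rule family_sum_superset[symmetric])
        (use support(1)[OF n(1)] sub in_carrier[OF s] support(2)[OF s] in auto)
    finally show ?thesis
      using s by (auto simp: sum_of_submodules_def)
  qed
  show "\<ominus>\<^bsub>M\<^esub> a \<in> sum_of_submodules M I N" if a: "a \<in> sum_of_submodules M I N" for a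
  proof -
    have "a \<in> carrier M"
      using \<open>sum_of_submodules M I N \<subseteq> carrier M\<close> a by blast
    then have "\<ominus>\<^bsub>M\<^esub> a = (\<ominus>\<^bsub>R\<^esub> \<one>\<^bsub>R\<^esub>) \<odot>\<^bsub>M\<^esub> a"
      by (simp add: smult_l_minus)
    then show ?thesis
      using smult[of "\<ominus>\<^bsub>R\<^esub> \<one>\<^bsub>R\<^esub>" a] a by simp
  qed
qed

lemma summand_subset_sum_of_submodules:
  assumes N: "\<And>i. i \<in> I \<Longrightarrow> submodule (N i) R M" and j: "j \<in> I" and a: "a \<in> N j"
  shows "a \<in> sum_of_submodules M I N"
proof -
  let ?n = "\<lambda>i. if i = j then a else \<zero>\<^bsub>M\<^esub>"
  have "a \<in> carrier M"
    using a submoduleE(1)[OF N[OF j]] by blast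
  then have "family_sum M I ?n = finsum M ?n {j}"
    using j by (intro family_sum_superset) auto
  also have "\<dots> = a"
    using \<open>a \<in> carrier M\<close> by simp
  finally have "a = family_sum M I ?n" ..
  moreover have "?n \<in> fin_families M I N"
    using a j submodule_zero[OF N] finite_subset[of "{i \<in> I. ?n i \<noteq> \<zero>\<^bsub>M\<^esub>}" "{j}"]
    by (auto simp: fin_families_def)
  ultimately show ?thesis
    by (auto simp: sum_of_submodules_def)
qed

lemma sum_of_submodules_induct [consumes 1, case_names submodule zero summand add]:
  assumes m: "m \<in> sum_of_submodules M I N"
    and N: "\<And>i. i \<in> I \<Longrightarrow> submodule (N i) R M"
    and zero: "P \<zero>\<^bsub>M\<^esub>"
    and summand: "\<And>i a. i \<in> I \<Longrightarrow> a \<in> N i \<Longrightarrow> P a"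
    and add: "\<And>a b. a \<in> carrier M \<Longrightarrow> b \<in> carrier M \<Longrightarrow> P a \<Longrightarrow> P b \<Longrightarrow> P (a \<oplus>\<^bsub>M\<^esub> b)"
  shows "P m"
proof -
  obtain n where n: "n \<in> fin_families M I N" "m = family_sum M I n"
    using m by (auto simp: sum_of_submodules_def)
  have "P (finsum M n A)" if "finite A" "A \<subseteq> I" for A
    using that
  proof (induction A rule: finite_induct)
    case (insert i A)
    have "n j \<in> N j" "n j \<in> carrier M" if "j \<in> I" for j
      using that n(1) submoduleE(1)[OF N] by (auto simp: fin_families_def)
    then have "finsum M n (insert i A) = n i \<oplus>\<^bsub>M\<^esub> finsum M n A"
        and "n i \<in> carrier M" "finsum M n A \<in> carrier M" "P (n i)"
      using insert.hyps insert.prems summand[of i]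
      by (auto intro!: M.finsum_insert M.finsum_closed)
    then show ?case
      using insert add by simp
  qed (simp add: zero)
  then show ?thesis
    using n by (simp add: family_sum_def fin_families_def)
qed

lemma direct_sum_submodule:
  assumes "is_direct_sum R M I N" "J \<subseteq> I" "i \<in> J"
  shows "submodule (N i) R M"
  using assms by (auto simp: is_direct_sum_def)

text \<open>
  A family on a part of the index set extends by zero to a family on the whole set with the same
  sum.  An element in both partial sums thus has two decompositions with disjoint supports, and
  by uniqueness both vanish.
\<close>

lemma direct_sum_partial_sums_disjoint:
  assumes D: "is_direct_sum R M I N" and J: "J \<subseteq> I" and K: "K \<subseteq> I" and "J \<inter> K = {}"
    and mJ: "m \<in> sum_of_submodules M J N" and mK: "m \<in> sum_of_submodules M K N"
  shows "m = \<zero>\<^bsub>M\<^esub>"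
proof -
  have extend: "n \<in> fin_families M I N \<and> family_sum M I n = family_sum M L n"
    if L: "L \<subseteq> I" and n: "n \<in> fin_families M L N" for L n
  proof -
    have "{i \<in> I. n i \<noteq> \<zero>\<^bsub>M\<^esub>} = {i \<in> L. n i \<noteq> \<zero>\<^bsub>M\<^esub>}"
      using L n by (auto simp: fin_families_def)
    moreover have "n i \<in> N i" if "i \<in> I" for i
      using n that submodule_zero[OF direct_sum_submodule[OF D order_refl that]]
      by (cases "i \<in> L") (auto simp: fin_families_def)
    ultimately show ?thesis
      using L n by (auto simp: fin_families_def family_sum_def)
  qed
  obtain n where n: "n \<in> fin_families M J N" "m = family_sum M J n"
    using mJ by (auto simp: sum_of_submodules_def)
  obtain k where k: "k \<in> fin_families M K N" "m = family_sum M K k"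
    using mK by (auto simp: sum_of_submodules_def)
  have "submodule (sum_of_submodules M J N) R M"
    by (rule sum_of_submodules_submodule) (rule direct_sum_submodule[OF D J])
  then have "m \<in> carrier M"
    using mJ submoduleE(1) by blast
  then have "\<exists>!n. n \<in> fin_families M I N \<and> m = family_sum M I n"
    using D unfolding is_direct_sum_def by blast
  moreover have "n \<in> fin_families M I N \<and> m = family_sum M I n"
      "k \<in> fin_families M I N \<and> m = family_sum M I k"
    using extend[OF J n(1)] extend[OF K k(1)] n(2) k(2) by auto
  ultimately have "n = k"
    by blast
  then have "n i = \<zero>\<^bsub>M\<^esub>" for i
    using n(1) k(1) \<open>J \<inter> K = {}\<close> by (auto simp: fin_families_def)
  then show ?thesis
    using n(2) by (simp add: family_sum_def)
qed

text \<open>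
  Comparison of components of degree \<open>g\<close>: the difference of the two sides lies both in \<open>N g\<close> and
  in the sum of the other summands.
\<close>

lemma direct_sum_compare_component:
  assumes D: "is_direct_sum R M I N" and g: "g \<in> I" and A: "finite A" "k \<in> A"
    and total: "finsum M c A \<in> N g" and ck: "c k \<in> N g"
    and other: "\<And>i. i \<in> A - {k} \<Longrightarrow> c i \<in> sum_of_submodules M (I - {g}) N"
  shows "finsum M c A = c k"
proof -
  note N = direct_sum_submodule[OF D]
  note S = sum_of_submodules_submodule[of "I - {g}" N, OF N[OF Diff_subset]]
  let ?rest = "finsum M c (A - {k})"
  have rest: "?rest \<in> sum_of_submodules M (I - {g}) N"
    by (rule submodule_sum_closed[OF S other])
  have car: "c i \<in> carrier M" if "i \<in> A" for i
    using that ck other[of i] submoduleE(1)[OF S] submoduleE(1)[OF N[OF order_refl g]]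
    by (cases "i = k") auto
  have rest_car: "?rest \<in> carrier M"
    using rest submoduleE(1)[OF S] by blast
  have "finsum M c (insert k (A - {k})) = c k \<oplus>\<^bsub>M\<^esub> ?rest"
    using A car by (intro M.finsum_insert) auto
  then have split: "finsum M c A = c k \<oplus>\<^bsub>M\<^esub> ?rest"
    using A(2) by (simp add: insert_absorb)
  have "?rest = \<ominus>\<^bsub>M\<^esub> c k \<oplus>\<^bsub>M\<^esub> finsum M c A"
    unfolding split using rest_car car[OF A(2)] by (simp add: M.r_neg1)
  also have "\<dots> \<in> N g"
    using submoduleE[OF N[OF order_refl g]] total ck by blast
  finally have "?rest \<in> sum_of_submodules M {g} N"
    using g by (intro summand_subset_sum_of_submodules N[of "{g}"]) auto
  then have "?rest = \<zero>\<^bsub>M\<^esub>"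
    using g rest by (intro direct_sum_partial_sums_disjoint[OF D, of "{g}" "I - {g}"]) auto
  then show ?thesis
    using split car[OF A(2)] by simp
qed

end


section \<open>Inverses in a groupoid\<close>

context groupoid
begin

lemma is_inverse_unique:
  assumes g: "g \<in> Mor G" and h: "is_inverse G g h" and k: "is_inverse G g k"
  shows "h = k"
proof -
  have h': "h \<in> Mor G" "Src G h = Tgt G g" "h \<star> g = Ident G (Src G g)"
    using h by (auto simp: is_inverse_def)
  have k': "k \<in> Mor G" "Tgt G k = Src G g" "g \<star> k = Ident G (Tgt G g)"
    using k by (auto simp: is_inverse_def)
  have "h = h \<star> (g \<star> k)"
    unfolding k'(3) h'(2)[symmetric] using Ident_right[OF h'(1)] ..
  also have "\<dots> = (h \<star> g) \<star> k"
    using Cmp_assoc[OF h'(1) g k'(1) h'(2) k'(2)[symmetric]] ..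
  also have "\<dots> = k"
    unfolding h'(3) k'(2)[symmetric] by (rule Ident_left[OF k'(1)])
  finally show ?thesis .
qed

lemma ginv_is_inverse:
  assumes "g \<in> Mor G"
  shows "is_inverse G g (ginv G g)"
  unfolding ginv_def
  by (rule theI') (use invertible[OF assms] is_inverse_unique[OF assms] in blast)

lemma ginv_closed [simp]: "g \<in> Mor G \<Longrightarrow> ginv G g \<in> Mor G"
  and Src_ginv [simp]: "g \<in> Mor G \<Longrightarrow> Src G (ginv G g) = Tgt G g"
  and Tgt_ginv [simp]: "g \<in> Mor G \<Longrightarrow> Tgt G (ginv G g) = Src G g"
  and gd_eq: "g \<in> Mor G \<Longrightarrow> gd G g = Ident G (Src G g)"
  and gr_eq: "g \<in> Mor G \<Longrightarrow> gr G g = Ident G (Tgt G g)"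
  using ginv_is_inverse[of g] by (auto simp: is_inverse_def gd_def gr_def)

lemma Ident_eq_iff: "a \<in> Objs G \<Longrightarrow> b \<in> Objs G \<Longrightarrow> Ident G a = Ident G b \<longleftrightarrow> a = b"
  using Src_Ident by metis

lemma gd_eq_gr_iff: "t \<in> Mor G \<Longrightarrow> s \<in> Mor G \<Longrightarrow> gd G t = gr G s \<longleftrightarrow> Src G t = Tgt G s"
  by (simp add: gd_eq gr_eq Ident_eq_iff Src_closed Tgt_closed)

lemma gr_eq_gr_iff: "t \<in> Mor G \<Longrightarrow> s \<in> Mor G \<Longrightarrow> gr G t = gr G s \<longleftrightarrow> Tgt G t = Tgt G s"
  by (simp add: gr_eq Ident_eq_iff Tgt_closed)

lemma ginv_Cmp_cancel:
  assumes "u \<in> Mor G" "t \<in> Mor G" "s \<in> Mor G" "Tgt G u = Tgt G t" "Tgt G t = Tgt G s"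
  shows "(ginv G u \<star> t) \<star> (ginv G t \<star> s) = ginv G u \<star> s"
proof -
  have "(ginv G u \<star> t) \<star> (ginv G t \<star> s) = ginv G u \<star> ((t \<star> ginv G t) \<star> s)"
    using assms by (simp add: Cmp_assoc Cmp_closed Src_Cmp Tgt_Cmp)
  also have "(t \<star> ginv G t) \<star> s = s"
    using assms ginv_is_inverse[of t] Ident_left[of s] by (simp add: is_inverse_def)
  finally show ?thesis .
qed

lemma Cmp_eq_left_imp_identity:
  assumes "g \<in> Mor G" "h \<in> Mor G" "Src G g = Tgt G h" "g \<star> h = g"
  shows "h = Ident G (Src G g)"
proof -
  have inv: "ginv G g \<star> g = Ident G (Src G g)"
    using ginv_is_inverse[OF assms(1)] by (simp add: is_inverse_def)
  have "h = (ginv G g \<star> g) \<star> h"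
    using assms(2,3) Ident_left[of h] by (simp add: inv)
  also have "\<dots> = ginv G g \<star> (g \<star> h)"
    by (rule Cmp_assoc) (use assms in simp_all)
  also have "\<dots> = Ident G (Src G g)"
    by (simp only: assms(4) inv)
  finally show ?thesis .
qed

lemma Cmp_eq_right_imp_identity:
  assumes "g \<in> Mor G" "h \<in> Mor G" "Src G h = Tgt G g" "h \<star> g = g"
  shows "h = Ident G (Tgt G g)"
proof -
  have inv: "g \<star> ginv G g = Ident G (Tgt G g)"
    using ginv_is_inverse[OF assms(1)] by (simp add: is_inverse_def)
  have "h = h \<star> (g \<star> ginv G g)"
    using assms(2,3) Ident_right[of h] by (simp add: inv)
  also have "\<dots> = (h \<star> g) \<star> ginv G g"
    by (rule Cmp_assoc[symmetric]) (use assms in simp_all)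
  also have "\<dots> = Ident G (Tgt G g)"
    by (simp only: assms(4) inv)
  finally show ?thesis .
qed

end


section \<open>Composition of finite sums\<close>

context R_semicategory
begin

lemma SComp_zero_right:
  assumes "x \<in> SObj C" "y \<in> SObj C" "z \<in> SObj C" "f \<in> carrier (SHom C z y)"
  shows "SComp C z y x f \<zero>\<^bsub>SHom C y x\<^esub> = \<zero>\<^bsub>SHom C z x\<^esub>"
proof -
  interpret M: module R "SHom C y x" using SHom_module assms by blast
  interpret N: module R "SHom C z x" using SHom_module assms by blast
  let ?v = "SComp C z y x f \<zero>\<^bsub>SHom C y x\<^esub>"
  have "?v \<in> carrier (SHom C z x)" "?v \<oplus>\<^bsub>SHom C z x\<^esub> ?v = ?v"
    using SComp_closed[of x y z] SComp_add_right[of x y z f "\<zero>\<^bsub>SHom C y x\<^esub>" "\<zero>\<^bsub>SHom C y x\<^esub>"] assms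
    by auto
  then show ?thesis
    by (simp add: N.add.l_cancel_one')
qed

lemma SComp_zero_left:
  assumes "x \<in> SObj C" "y \<in> SObj C" "z \<in> SObj C" "g \<in> carrier (SHom C y x)"
  shows "SComp C z y x \<zero>\<^bsub>SHom C z y\<^esub> g = \<zero>\<^bsub>SHom C z x\<^esub>"
proof -
  interpret M: module R "SHom C z y" using SHom_module assms by blast
  interpret N: module R "SHom C z x" using SHom_module assms by blast
  let ?v = "SComp C z y x \<zero>\<^bsub>SHom C z y\<^esub> g"
  have "?v \<in> carrier (SHom C z x)" "?v \<oplus>\<^bsub>SHom C z x\<^esub> ?v = ?v"
    using SComp_closed[of x y z] SComp_add_left[of x y z "\<zero>\<^bsub>SHom C z y\<^esub>" "\<zero>\<^bsub>SHom C z y\<^esub>" g] assms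
    by auto
  then show ?thesis
    by (simp add: N.add.l_cancel_one')
qed

lemma SComp_finsum_right:
  assumes obj: "x \<in> SObj C" "y \<in> SObj C" "z \<in> SObj C" and f: "f \<in> carrier (SHom C z y)"
    and "finite A" and c: "\<And>i. i \<in> A \<Longrightarrow> c i \<in> carrier (SHom C y x)"
  shows "SComp C z y x f (finsum (SHom C y x) c A) = finsum (SHom C z x) (\<lambda>i. SComp C z y x f (c i)) A"
  using \<open>finite A\<close> c
proof (induction A rule: finite_induct)
  interpret M: module R "SHom C y x" using SHom_module obj by blast
  interpret N: module R "SHom C z x" using SHom_module obj by blast
  {
    case empty
    show ?case using SComp_zero_right obj f by simp
  next
    case (insert i A)
    then have "SComp C z y x f (c j) \<in> carrier (SHom C z x)" if "j \<in> insert i A" for j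
      using that SComp_closed obj f by blast
    then show ?case
      using insert obj f by (simp add: Pi_iff SComp_add_right M.finsum_closed)
  }
qed

lemma SComp_finsum_left:
  assumes obj: "x \<in> SObj C" "y \<in> SObj C" "z \<in> SObj C" and g: "g \<in> carrier (SHom C y x)"
    and "finite A" and c: "\<And>i. i \<in> A \<Longrightarrow> c i \<in> carrier (SHom C z y)"
  shows "SComp C z y x (finsum (SHom C z y) c A) g = finsum (SHom C z x) (\<lambda>i. SComp C z y x (c i) g) A"
  using \<open>finite A\<close> c
proof (induction A rule: finite_induct)
  interpret M: module R "SHom C z y" using SHom_module obj by blast
  interpret N: module R "SHom C z x" using SHom_module obj by blast
  {
    case empty
    show ?case using SComp_zero_left obj g by simp
  next
    case (insert i A)
    then have "SComp C z y x (c j) g \<in> carrier (SHom C z x)" if "j \<in> insert i A" for j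
      using that SComp_closed obj g by blast
    then show ?case
      using insert obj g by (simp add: Pi_iff SComp_add_left M.finsum_closed)
  }
qed

end


section \<open>Semicategories of submodules\<close>

text \<open>
  Both \<open>tensor_gpd\<close> and \<open>smash_gpd\<close> have this shape: objects lie over those of \<open>C\<close> via \<open>p\<close>, and
  the morphisms between two of them are a submodule of the morphisms of \<open>C\<close> below.
\<close>

definition pullback_semicat ::
    "('o, 'r, 'm, 'v) semicat_scheme \<Rightarrow> 'p set \<Rightarrow> ('p \<Rightarrow> 'o) \<Rightarrow> ('p \<Rightarrow> 'p \<Rightarrow> 'm set)
      \<Rightarrow> ('p, 'r, 'm) semicat" where
  "pullback_semicat C S p H =
    \<lparr> SObj = S,
      SHom = (\<lambda>b a. (SHom C (p b) (p a))\<lparr>carrier := H b a\<rparr>),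
      SComp = (\<lambda>c b a. SComp C (p c) (p b) (p a)) \<rparr>"

lemma (in R_semicategory) pullback_R_category:
  assumes p: "\<And>a. a \<in> S \<Longrightarrow> p a \<in> SObj C"
    and H: "\<And>a b. a \<in> S \<Longrightarrow> b \<in> S \<Longrightarrow> submodule (H b a) R (SHom C (p b) (p a))"
    and comp: "\<And>a b c f g. a \<in> S \<Longrightarrow> b \<in> S \<Longrightarrow> c \<in> S \<Longrightarrow> f \<in> H c b \<Longrightarrow> g \<in> H b a
                 \<Longrightarrow> SComp C (p c) (p b) (p a) f g \<in> H c a"
    and ident: "\<And>a. a \<in> S \<Longrightarrow> \<exists>i \<in> H a a. \<forall>b \<in> S.
                 (\<forall>f \<in> H b a. SComp C (p b) (p a) (p a) f i = f) \<and>
                 (\<forall>f \<in> H a b. SComp C (p a) (p a) (p b) i f = f)"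
  shows "R_category R (pullback_semicat C S p H)"
proof -
  have sub: "f \<in> carrier (SHom C (p b) (p a))" if "a \<in> S" "b \<in> S" "f \<in> H b a" for a b f
    using module.submoduleE(1)[OF SHom_module H] that p by blast
  have mod: "module R ((SHom C (p b) (p a))\<lparr>carrier := H b a\<rparr>)" if "a \<in> S" "b \<in> S" for a b
    using submodule.submodule_is_module[OF H SHom_module] that p by blast
  show ?thesis
  proof (intro R_category.intro R_semicategory.intro)
    show "cring R" ..
    show "R_semicategory_axioms R (pullback_semicat C S p H)"
      by (rule R_semicategory_axioms.intro)
        (use mod comp in \<open>simp_all add: pullback_semicat_def p sub SComp_assoc SComp_add_left
          SComp_add_right SComp_smult_left SComp_smult_right\<close>)
    show "R_category_axioms (pullback_semicat C S p H)"
      by (rule R_category_axioms.intro) (use ident in \<open>simp add: pullback_semicat_def\<close>)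
  qed
qed


section \<open>Homogeneous components of identity morphisms\<close>

context graded_R_semicategory
begin

lemma Deg_submodule:
  assumes "x \<in> SObj B" "y \<in> SObj B" "g \<in> Mor G"
  shows "submodule (Deg B y x g) R (SHom B y x)"
  using Deg_direct_sum assms by (simp add: is_direct_sum_def)

lemma Deg_carrier:
  assumes "x \<in> SObj B" "y \<in> SObj B" "g \<in> Mor G" "f \<in> Deg B y x g"
  shows "f \<in> carrier (SHom B y x)"
  using module.submoduleE(1)[OF SHom_module Deg_submodule] assms by blast

text \<open>
  A degree \<open>k\<close> of interest is put into the finite index set even if the component of that degree
  is zero, so that its term can be split off the sum without a case distinction.
\<close>

lemma Deg_decomposition:
  assumes x: "x \<in> SObj B" and y: "y \<in> SObj B" and m: "m \<in> carrier (SHom B y x)" and k: "k \<in> Mor G"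
  obtains n A where "finite A" "A \<subseteq> Mor G" "k \<in> A" "\<And>h. h \<in> Mor G \<Longrightarrow> n h \<in> Deg B y x h"
    "m = finsum (SHom B y x) n A"
proof -
  interpret M: module R "SHom B y x" using SHom_module x y by blast
  obtain n where n: "n \<in> fin_families (SHom B y x) (Mor G) (Deg B y x)"
      "m = family_sum (SHom B y x) (Mor G) n"
    using Deg_direct_sum[OF x y] m unfolding is_direct_sum_def by blast
  let ?A = "insert k {h \<in> Mor G. n h \<noteq> \<zero>\<^bsub>SHom B y x\<^esub>}"
  have deg: "n h \<in> Deg B y x h" if "h \<in> Mor G" for h
    using n(1) that by (simp add: fin_families_def)
  have "family_sum (SHom B y x) (Mor G) n = finsum (SHom B y x) n ?A"
    by (rule M.family_sum_superset)
      (use n(1) k Deg_carrier[OF x y] deg in \<open>auto simp: fin_families_def\<close>)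
  then have m_sum: "m = finsum (SHom B y x) n ?A"
    using n(2) by simp
  have A: "finite ?A" "?A \<subseteq> Mor G" "k \<in> ?A"
    using n(1) k by (auto simp: fin_families_def)
  show thesis
    by (rule that[OF A deg m_sum])
qed

end

context graded_R_category
begin

text \<open>
  The witness is the component, of degree the identity at \<open>a\<close>, of the identity morphism of \<open>x\<close>.
  Multiplied with a homogeneous \<open>f\<close> of degree \<open>g\<close>, every other component gives zero or an element
  of degree different from \<open>g\<close>, by cancellation in the groupoid, so it contributes nothing to the
  component \<open>f\<close> of degree \<open>g\<close>.
\<close>

lemma homogeneous_local_identity:
  assumes x: "x \<in> SObj B" and a: "a \<in> Objs G"
  shows "\<exists>i \<in> Deg B x x (Ident G a).
    (\<forall>y \<in> SObj B. \<forall>g \<in> Mor G. Src G g = a \<longrightarrow> (\<forall>f \<in> Deg B y x g. SComp B y x x f i = f)) \<and>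
    (\<forall>y \<in> SObj B. \<forall>g \<in> Mor G. Tgt G g = a \<longrightarrow> (\<forall>f \<in> Deg B x y g. SComp B x x y i f = f))"
proof -
  let ?e = "Ident G a"
  have e: "?e \<in> Mor G" "Src G ?e = a" "Tgt G ?e = a"
    using a Ident_closed Src_Ident Tgt_Ident by auto
  obtain j where j: "j \<in> carrier (SHom B x x)"
    and j_right: "\<And>y f. y \<in> SObj B \<Longrightarrow> f \<in> carrier (SHom B y x) \<Longrightarrow> SComp B y x x f j = f"
    and j_left: "\<And>y f. y \<in> SObj B \<Longrightarrow> f \<in> carrier (SHom B x y) \<Longrightarrow> SComp B x x y j f = f"
    using identity_exists[OF x] by blast
  obtain n A where A: "finite A" "A \<subseteq> Mor G" "?e \<in> A"
    and n: "\<And>h. h \<in> Mor G \<Longrightarrow> n h \<in> Deg B x x h" and j_sum: "j = finsum (SHom B x x) n A"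
    using Deg_decomposition[OF x x j e(1)] by metis
  have n_car: "n h \<in> carrier (SHom B x x)" if "h \<in> A" for h
    using Deg_carrier[OF x x] n that A(2) by blast
  have right: "SComp B y x x f (n ?e) = f"
    if y: "y \<in> SObj B" and g: "g \<in> Mor G" "Src G g = a" and f: "f \<in> Deg B y x g" for y g f
  proof -
    interpret M: module R "SHom B y x" using SHom_module x y by blast
    let ?c = "\<lambda>h. SComp B y x x f (n h)"
    have f_car: "f \<in> carrier (SHom B y x)"
      using Deg_carrier x y g f by blast
    have f_sum: "f = finsum (SHom B y x) ?c A"
      using j_right[OF y f_car] SComp_finsum_right[OF x x y f_car A(1) n_car] j_sum by simp
    have sub: "submodule (Deg B y x h) R (SHom B y x)" if "h \<in> Mor G - {g}" for h
      using Deg_submodule x y that by blast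
    have "finsum (SHom B y x) ?c A = ?c ?e"
    proof (rule M.direct_sum_compare_component[OF Deg_direct_sum[OF x y] g(1) A(1,3)])
      show "finsum (SHom B y x) ?c A \<in> Deg B y x g"
        using f f_sum by simp
      show "?c ?e \<in> Deg B y x g"
        using Deg_comp[OF x x y g(1) e(1) _ f n[OF e(1)]] g e Ident_right[OF g(1)]
        by (simp add: gd_eq_gr_iff)
      fix h assume h: "h \<in> A - {?e}"
      then have hM: "h \<in> Mor G" using A(2) by blast
      show "?c h \<in> sum_of_submodules (SHom B y x) (Mor G - {g}) (Deg B y x)"
      proof (cases "Src G g = Tgt G h")
        case True
        then have "?c h \<in> Deg B y x (g \<star>\<^bsub>G\<^esub> h)"
          using Deg_comp[OF x x y g(1) hM _ f n[OF hM]] by (simp add: gd_eq_gr_iff g hM)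
        moreover have "g \<star>\<^bsub>G\<^esub> h \<in> Mor G - {g}"
          using Cmp_closed[OF g(1) hM True] Cmp_eq_left_imp_identity[OF g(1) hM True] h g(2)
          by blast
        ultimately show ?thesis
          by (intro M.summand_subset_sum_of_submodules[OF sub])
      next
        case False
        then have "?c h = \<zero>\<^bsub>SHom B y x\<^esub>"
          using Deg_comp_zero[OF x x y g(1) hM _ f n[OF hM]] by (simp add: gd_eq_gr_iff g hM)
        then show ?thesis
          by (simp only:) (intro M.submodule_zero M.sum_of_submodules_submodule sub)
      qed
    qed
    then show ?thesis using f_sum by simp
  qed
  have left: "SComp B x x y (n ?e) f = f"
    if y: "y \<in> SObj B" and g: "g \<in> Mor G" "Tgt G g = a" and f: "f \<in> Deg B x y g" for y g f
  proof -
    interpret M: module R "SHom B x y" using SHom_module x y by blast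
    let ?c = "\<lambda>h. SComp B x x y (n h) f"
    have f_car: "f \<in> carrier (SHom B x y)"
      using Deg_carrier x y g f by blast
    have f_sum: "f = finsum (SHom B x y) ?c A"
      using j_left[OF y f_car] SComp_finsum_left[OF y x x f_car A(1) n_car] j_sum by simp
    have sub: "submodule (Deg B x y h) R (SHom B x y)" if "h \<in> Mor G - {g}" for h
      using Deg_submodule x y that by blast
    have "finsum (SHom B x y) ?c A = ?c ?e"
    proof (rule M.direct_sum_compare_component[OF Deg_direct_sum[OF y x] g(1) A(1,3)])
      show "finsum (SHom B x y) ?c A \<in> Deg B x y g"
        using f f_sum by simp
      show "?c ?e \<in> Deg B x y g"
        using Deg_comp[OF y x x e(1) g(1) _ n[OF e(1)] f] g e Ident_left[OF g(1)]
        by (simp add: gd_eq_gr_iff)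
      fix h assume h: "h \<in> A - {?e}"
      then have hM: "h \<in> Mor G" using A(2) by blast
      show "?c h \<in> sum_of_submodules (SHom B x y) (Mor G - {g}) (Deg B x y)"
      proof (cases "Src G h = Tgt G g")
        case True
        then have "?c h \<in> Deg B x y (h \<star>\<^bsub>G\<^esub> g)"
          using Deg_comp[OF y x x hM g(1) _ n[OF hM] f] by (simp add: gd_eq_gr_iff g hM)
        moreover have "h \<star>\<^bsub>G\<^esub> g \<in> Mor G - {g}"
          using Cmp_closed[OF hM g(1) True] Cmp_eq_right_imp_identity[OF g(1) hM True] h g(2)
          by blast
        ultimately show ?thesis
          by (intro M.summand_subset_sum_of_submodules[OF sub])
      next
        case False
        then have "?c h = \<zero>\<^bsub>SHom B x y\<^esub>"
          using Deg_comp_zero[OF y x x hM g(1) _ n[OF hM] f] by (simp add: gd_eq_gr_iff g hM)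
        then show ?thesis
          by (simp only:) (intro M.submodule_zero M.sum_of_submodules_submodule sub)
      qed
    qed
    then show ?thesis using f_sum by simp
  qed
  show ?thesis
    by (rule bexI[of _ "n ?e"]) (use n[OF e(1)] right left in blast)+
qed


section \<open>The tensor product and the smash product\<close>

lemma tensor_gpd_pullback:
  "tensor_gpd B G = pullback_semicat B (SObj B \<times> identities G) fst
     (\<lambda>b a. sum_of_submodules (SHom B (fst b) (fst a)) (gpd_hom G (snd b) (snd a))
       (Deg B (fst b) (fst a)))"
  by (simp add: tensor_gpd_def pullback_semicat_def fun_eq_iff split_beta)

lemma smash_gpd_pullback:
  "smash_gpd B G = pullback_semicat B (SObj B \<times> Mor G) fst
     (\<lambda>b a. if gr G (snd b) = gr G (snd a)
       then Deg B (fst b) (fst a) (ginv G (snd b) \<star>\<^bsub>G\<^esub> snd a) else {\<zero>\<^bsub>SHom B (fst b) (fst a)\<^esub>})"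
  by (simp add: smash_gpd_def pullback_semicat_def fun_eq_iff split_beta)

lemma gpd_hom_sum_submodule:
  assumes "x \<in> SObj B" "y \<in> SObj B"
  shows "submodule (sum_of_submodules (SHom B y x) (gpd_hom G p q) (Deg B y x)) R (SHom B y x)"
  by (rule module.sum_of_submodules_submodule[OF SHom_module])
    (use Deg_submodule assms in \<open>simp_all add: gpd_hom_def\<close>)

lemma gpd_hom_sum_carrier:
  assumes "x \<in> SObj B" "y \<in> SObj B"
    and "f \<in> sum_of_submodules (SHom B y x) (gpd_hom G p q) (Deg B y x)"
  shows "f \<in> carrier (SHom B y x)"
  using module.submoduleE(1)[OF SHom_module gpd_hom_sum_submodule] assms by blast

text \<open>
  By biadditivity it is enough to compose homogeneous \<open>f\<close> and \<open>g\<close>.  Their degrees meet at \<open>q\<close>, so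
  they are composable in the groupoid.
\<close>

lemma gpd_hom_sum_comp:
  assumes x: "x \<in> SObj B" and y: "y \<in> SObj B" and z: "z \<in> SObj B"
    and f: "f \<in> sum_of_submodules (SHom B z y) (gpd_hom G r q) (Deg B z y)"
    and g: "g \<in> sum_of_submodules (SHom B y x) (gpd_hom G q p) (Deg B y x)"
  shows "SComp B z y x f g \<in> sum_of_submodules (SHom B z x) (gpd_hom G r p) (Deg B z x)"
    (is "_ \<in> ?S")
proof -
  interpret zy: module R "SHom B z y" using SHom_module y z by blast
  interpret yx: module R "SHom B y x" using SHom_module x y by blast
  interpret zx: module R "SHom B z x" using SHom_module x z by blast
  note S = gpd_hom_sum_submodule[OF x z, of r p]
  note g_car = gpd_hom_sum_carrier[OF x y g]
  have homogeneous: "SComp B z y x f' g' \<in> ?S"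
    if t: "t \<in> gpd_hom G r q" and f': "f' \<in> Deg B z y t"
      and s: "s \<in> gpd_hom G q p" and g': "g' \<in> Deg B y x s" for t s f' g'
  proof -
    have ts: "t \<in> Mor G" "s \<in> Mor G" "gd G t = gr G s" "Src G t = Tgt G s"
      using t s by (auto simp: gpd_hom_def simp flip: gd_eq_gr_iff)
    have "t \<star>\<^bsub>G\<^esub> s \<in> gpd_hom G r p"
      using t s ts by (auto simp: gpd_hom_def gd_eq gr_eq Cmp_closed Src_Cmp Tgt_Cmp)
    then show ?thesis
      by (rule zx.summand_subset_sum_of_submodules[rotated])
        (use Deg_comp[OF x y z ts(1-3) f' g'] Deg_submodule[OF x z] in \<open>simp_all add: gpd_hom_def\<close>)
  qed
  have left_homogeneous: "SComp B z y x f' g \<in> ?S"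
    if t: "t \<in> gpd_hom G r q" and f': "f' \<in> Deg B z y t" for t f'
  proof -
    have f'_car: "f' \<in> carrier (SHom B z y)"
      using Deg_carrier[OF y z _ f'] t by (simp add: gpd_hom_def)
    show ?thesis
      using g
    proof (induction g rule: yx.sum_of_submodules_induct)
      case (submodule s)
      then show ?case using Deg_submodule[OF x y] by (simp add: gpd_hom_def)
    next
      case zero
      then show ?case using SComp_zero_right[OF x y z f'_car] zx.submodule_zero[OF S] by simp
    next
      case (summand s g')
      then show ?case using homogeneous[OF t f'] by blast
    next
      case (add g1 g2)
      then show ?case
        using SComp_add_right[OF x y z f'_car] zx.submoduleE(5)[OF S] by simp
    qed
  qed
  show ?thesis
    using f
  proof (induction f rule: zy.sum_of_submodules_induct)
    case (submodule t)
    then show ?case using Deg_submodule[OF y z] by (simp add: gpd_hom_def)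
  next
    case zero
    then show ?case using SComp_zero_left[OF x y z g_car] zx.submodule_zero[OF S] by simp
  next
    case (summand t f')
    then show ?case using left_homogeneous by blast
  next
    case (add f1 f2)
    then show ?case
      using SComp_add_left[OF x y z _ _ g_car] zx.submoduleE(5)[OF S] by simp
  qed
qed

text \<open>
  The local identity at \<open>(x, e)\<close> fixes the homogeneous morphisms, and the morphisms that it fixes
  are closed under addition.
\<close>

lemma tensor_gpd_R_category: "R_category R (tensor_gpd B G)"
  unfolding tensor_gpd_pullback
proof (rule pullback_R_category, goal_cases)
  case (1 a)
  then show ?case by auto
next
  case (2 a b)
  then show ?case by (auto intro: gpd_hom_sum_submodule)
next
  case (3 a b c f g)
  then show ?case by (auto intro: gpd_hom_sum_comp)
next
  case (4 u)
  then obtain x a where u: "u = (x, Ident G a)" and x: "x \<in> SObj B" and a: "a \<in> Objs G"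
    by (auto simp: identities_def)
  let ?e = "Ident G a"
  let ?H = "\<lambda>y x q p. sum_of_submodules (SHom B y x) (gpd_hom G q p) (Deg B y x)"
  have e: "?e \<in> Mor G" "Src G ?e = a" "Tgt G ?e = a"
    using a Ident_closed Src_Ident Tgt_Ident by auto
  obtain i where i: "i \<in> Deg B x x ?e"
    and i_right: "\<And>y g f. y \<in> SObj B \<Longrightarrow> g \<in> Mor G \<Longrightarrow> Src G g = a \<Longrightarrow> f \<in> Deg B y x g
                    \<Longrightarrow> SComp B y x x f i = f"
    and i_left: "\<And>y g f. y \<in> SObj B \<Longrightarrow> g \<in> Mor G \<Longrightarrow> Tgt G g = a \<Longrightarrow> f \<in> Deg B x y g
                    \<Longrightarrow> SComp B x x y i f = f"
    using homogeneous_local_identity[OF x a] by blast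
  have i_car: "i \<in> carrier (SHom B x x)"
    using Deg_carrier[OF x x e(1) i] .
  have i_H: "i \<in> ?H x x ?e ?e"
    by (rule module.summand_subset_sum_of_submodules[where j = ?e, OF SHom_module[OF x x]])
      (use Deg_submodule[OF x x] i e in \<open>simp_all add: gpd_hom_def gd_eq gr_eq\<close>)
  have right: "SComp B y x x f i = f" if y: "y \<in> SObj B" and f: "f \<in> ?H y x q ?e" for y q f
  proof -
    interpret M: module R "SHom B y x" using SHom_module x y by blast
    show ?thesis
      using f
    proof (induction f rule: M.sum_of_submodules_induct)
      case (submodule g)
      then show ?case using Deg_submodule[OF x y] by (simp add: gpd_hom_def)
    next
      case zero
      then show ?case by (rule SComp_zero_left[OF x x y i_car])
    next
      case (summand g f)
      then have "g \<in> Mor G" "Src G g = a"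
        using a by (auto simp: gpd_hom_def gd_eq Ident_eq_iff Src_closed)
      then show ?case using i_right y summand by blast
    next
      case (add f1 f2)
      then show ?case using SComp_add_left[OF x x y _ _ i_car] by simp
    qed
  qed
  have left: "SComp B x x y i f = f" if y: "y \<in> SObj B" and f: "f \<in> ?H x y ?e q" for y q f
  proof -
    interpret M: module R "SHom B x y" using SHom_module x y by blast
    show ?thesis
      using f
    proof (induction f rule: M.sum_of_submodules_induct)
      case (submodule g)
      then show ?case using Deg_submodule[OF y x] by (simp add: gpd_hom_def)
    next
      case zero
      then show ?case by (rule SComp_zero_right[OF y x x i_car])
    next
      case (summand g f)
      then have "g \<in> Mor G" "Tgt G g = a"
        using a by (auto simp: gpd_hom_def gr_eq Ident_eq_iff Tgt_closed)
      then show ?case using i_left y summand by blast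
    next
      case (add f1 f2)
      then show ?case using SComp_add_right[OF y x x i_car] by simp
    qed
  qed
  show ?case
    unfolding u by (rule bexI[of _ i]) (use i_H right left in auto)
qed

text \<open>
  Composites stay in the right degree since \<open>(u\<^sup>-\<^sup>1 t) (t\<^sup>-\<^sup>1 s) = u\<^sup>-\<^sup>1 s\<close>.  When two of the three
  targets differ, one of the factors is zero, although the composite may lie in a nonzero module.
\<close>

lemma smash_gpd_R_category: "R_category R (smash_gpd B G)"
  unfolding smash_gpd_pullback
proof (rule pullback_R_category, goal_cases)
  case (1 a)
  then show ?case by auto
next
  case (2 a b)
  then show ?case
    using module.zero_submodule[OF SHom_module]
    by (auto simp: gr_eq_gr_iff intro!: Deg_submodule Cmp_closed)
next
  case (3 a b c f g)
  obtain x s y t z u where abc: "a = (x, s)" "b = (y, t)" "c = (z, u)"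
    by (metis surj_pair)
  have obj: "x \<in> SObj B" "y \<in> SObj B" "z \<in> SObj B" and mor: "s \<in> Mor G" "t \<in> Mor G" "u \<in> Mor G"
    using 3 abc by auto
  interpret zx: module R "SHom B z x" using SHom_module obj by blast
  let ?H = "\<lambda>y x t s. if gr G t = gr G s then Deg B y x (ginv G t \<star>\<^bsub>G\<^esub> s) else {\<zero>\<^bsub>SHom B y x\<^esub>}"
  have H_sub: "submodule (?H y x t s) R (SHom B y x)"
    if "x \<in> SObj B" "y \<in> SObj B" "s \<in> Mor G" "t \<in> Mor G" for x y s t
    using that module.zero_submodule[OF SHom_module]
    by (auto simp: gr_eq_gr_iff intro!: Deg_submodule Cmp_closed)
  have H_car: "h \<in> carrier (SHom B y x)"
    if "h \<in> ?H y x t s" "x \<in> SObj B" "y \<in> SObj B" "s \<in> Mor G" "t \<in> Mor G" for h x y s t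
    using module.submoduleE(1)[OF SHom_module H_sub] that by blast
  have f: "f \<in> ?H z y u t" and g: "g \<in> ?H y x t s"
    using 3 abc by auto
  have zero: "\<zero>\<^bsub>SHom B z x\<^esub> \<in> ?H z x u s"
    by (rule zx.submodule_zero) (use H_sub obj mor in blast)
  have "SComp B z y x f g \<in> ?H z x u s"
  proof (cases "gr G u = gr G t \<and> gr G t = gr G s")
    case True
    then have tgt: "Tgt G u = Tgt G t" "Tgt G t = Tgt G s"
      using mor by (simp_all add: gr_eq_gr_iff)
    have "SComp B z y x f g \<in> Deg B z x ((ginv G u \<star>\<^bsub>G\<^esub> t) \<star>\<^bsub>G\<^esub> (ginv G t \<star>\<^bsub>G\<^esub> s))"
      using f g True tgt obj mor
      by (intro Deg_comp[where y = y]) (auto simp: gd_eq_gr_iff Cmp_closed Src_Cmp Tgt_Cmp)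
    then show ?thesis
      using ginv_Cmp_cancel[of u t s] True tgt mor by simp
  next
    case False
    then have "f = \<zero>\<^bsub>SHom B z y\<^esub> \<or> g = \<zero>\<^bsub>SHom B y x\<^esub>"
      using f g by (auto split: if_splits)
    then have "SComp B z y x f g = \<zero>\<^bsub>SHom B z x\<^esub>"
      using SComp_zero_left[OF obj H_car[OF g]] SComp_zero_right[OF obj H_car[OF f]] obj mor
      by auto
    then show ?thesis using zero by simp
  qed
  then show ?case by (simp only: abc fst_conv snd_conv)
next
  case (4 v)
  then obtain x s where v: "v = (x, s)" and x: "x \<in> SObj B" and s: "s \<in> Mor G"
    by auto
  let ?e = "Ident G (Src G s)"
  let ?H = "\<lambda>y x t s. if gr G t = gr G s then Deg B y x (ginv G t \<star>\<^bsub>G\<^esub> s) else {\<zero>\<^bsub>SHom B y x\<^esub>}"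
  obtain i where i: "i \<in> Deg B x x ?e"
    and i_right: "\<And>y g f. y \<in> SObj B \<Longrightarrow> g \<in> Mor G \<Longrightarrow> Src G g = Src G s \<Longrightarrow> f \<in> Deg B y x g
                    \<Longrightarrow> SComp B y x x f i = f"
    and i_left: "\<And>y g f. y \<in> SObj B \<Longrightarrow> g \<in> Mor G \<Longrightarrow> Tgt G g = Src G s \<Longrightarrow> f \<in> Deg B x y g
                    \<Longrightarrow> SComp B x x y i f = f"
    using homogeneous_local_identity[OF x Src_closed[OF s]] by blast
  have i_car: "i \<in> carrier (SHom B x x)"
    using Deg_carrier[OF x x _ i] Ident_closed Src_closed s by blast
  have i_H: "i \<in> ?H x x s s"
    using i s by (simp add: gd_def[symmetric] gd_eq)
  have right: "SComp B y x x f i = f"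
    if y: "y \<in> SObj B" and t: "t \<in> Mor G" and f: "f \<in> ?H y x t s" for y t f
  proof (cases "gr G t = gr G s")
    case True
    then show ?thesis
      using f y t s by (intro i_right) (auto simp: gr_eq_gr_iff Cmp_closed Src_Cmp)
  next
    case False
    then show ?thesis using f SComp_zero_left[OF x x y i_car] by simp
  qed
  have left: "SComp B x x y i f = f"
    if y: "y \<in> SObj B" and t: "t \<in> Mor G" and f: "f \<in> ?H x y s t" for y t f
  proof (cases "gr G s = gr G t")
    case True
    then show ?thesis
      using f y t s by (intro i_left) (auto simp: gr_eq_gr_iff Cmp_closed Tgt_Cmp)
  next
    case False
    then show ?thesis using f SComp_zero_right[OF y x x i_car] by simp
  qed
  show ?case
    unfolding v by (rule bexI[of _ i]) (use i_H right left in \<open>auto simp del: if_split\<close>)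
qed

end

theorem lemma5p6:
  fixes R :: "('r, 'u) ring_scheme"
    and G :: "('a, 'g, 'w) small_cat_scheme"
    and B :: "('o, 'r, 'm, 'g, 'v) graded_semicat_scheme"
  assumes "groupoid G"
    and "graded_R_category R G B"
    and "finite (identities G)"
  shows "R_category R (tensor_gpd B G) \<and> R_category R (smash_gpd B G)"
  using assms(2) graded_R_category.tensor_gpd_R_category graded_R_category.smash_gpd_R_category
  by blast

end
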